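(* Let $B=(b_{ij})\in\mathrm{M}_3(\mathbb{R})$ be a cluster-cyclic skew-symmetrizable matrix with skew-symmetrizer $D=\mathrm{diag}(d_1,d_2,d_3)$ and let $\mathbf w=[k_1,\dots,k_r]\in\mathcal T$ with $r\ge1$. For $i\ne j$ put $\eta_{ij}=-1$ if $k_1\in\{i,j\}$ and $\eta_{ij}=1$ otherwise (equivalently $\eta_{ij}=\varepsilon_i^{[k_1]}\varepsilon_j^{[k_1]}$). Then for each $i\in\{1,2,3\}$ the $c$-vector $\mathbf c_i^{\mathbf w}=(x_1,x_2,x_3)^{\top}$ satisfies $d_1x_1^2+d_2x_2^2+d_3x_3^2+\eta_{12}d_1|b_{12}|x_1x_2+\eta_{23}d_2|b_{23}|x_2x_3+\eta_{13}d_3|b_{31}|x_1x_3=d_i$. Explicitly: if $k_1=1$ the left side is $d_1x_1^2+d_2x_2^2+d_3x_3^2-d_1|b_{12}|x_1x_2+d_2|b_{23}|x_2x_3-d_3|b_{31}|x_1x_3$; if $k_1=2$ it is $d_1x_1^2+d_2x_2^2+d_3x_3^2-d_1|b_{12}|x_1x_2-d_2|b_{23}|x_2x_3+d_3|b_{31}|x_1x_3$; if $k_1=3$ it is $d_1x_1^2+d_2x_2^2+d_3x_3^2+d_1|b_{12}|x_1x_2-d_2|b_{23}|x_2x_3-d_3|b_{31}|x_1x_3$.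
   Context: A matrix $B=(b_{ij})\in\mathrm{M}_3(\mathbb{R})$ is skew-symmetrizable with skew-symmetrizer $D=\mathrm{diag}(d_1,d_2,d_3)$ ($d_i>0$) if $DB$ is skew-symmetric. Notation: $[a]_+=\max(a,0)$, entrywise on matrices; $J_k$ is diagonal with $k$th entry $-1$, others $1$; $A^{\bullet k}$ (resp. $A^{k\bullet}$) keeps only the $k$th column (resp. row) of $A$. Mutation: $\mu_k(B)=(J_k+[-B]_+^{\bullet k})B(J_k+[B]_+^{k\bullet})$. $\mathcal T$ is the set of reduced sequences $\mathbf w=[k_1,\dots,k_r]$ ($k_i\in\{1,2,3\}$, $k_i\ne k_{i+1}$), including $\emptyset$; $\mathbf w[k]$ appends $k$ if $\mathbf w=\emptyset$ or $k\ne k_r$ and deletes the last entry if $k=k_r$. $B^{\mathbf w}=\mu_{k_r}\cdots\mu_{k_1}(B)$. $C^\emptyset=I$, $C^{\mathbf w[k]}=C^{\mathbf w}J_k+C^{\mathbf w}[B^{\mathbf w}]_+^{k\bullet}+[-C^{\mathbf w}]_+^{\bullet k}B^{\mathbf w}$; the $i$th column of $C^{\mathbf w}$ is the $c$-vector $\mathbf c_i^{\mathbf w}$. $B$ is cyclic if $\mathrm{sign}(B)=\pm\begin{pmatrix}0&-1&1\\1&0&-1\\-1&1&0\end{pmatrix}$ entrywise; cluster-cyclic if all $B^{\mathbf w}$ are cyclic. Tropical signs: $\varepsilon_i^{[k]}=-1$ if $i=k$ and $1$ otherwise (these are the signs of the columns of $C^{[k]}$). *)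

theory Defs
  imports "HOL-Analysis.Analysis"
begin

text \<open>Matrix entries are addressed as \<open>A $ i $ j\<close> (row \<open>i\<close>, column \<open>j\<close>). The index type \<open>3\<close> has
  exactly the elements \<open>1\<close>, \<open>2\<close>, \<open>3\<close> (internally \<open>3 = 0\<close>).\<close>

definition diag_mat :: "real^'n \<Rightarrow> real^'n^'n" where
  "diag_mat v = (\<chi> i j. if i = j then v $ i else 0)"

definition is_skew_symmetrizer :: "real^'n \<Rightarrow> real^'n^'n \<Rightarrow> bool" where
  "is_skew_symmetrizer d B \<longleftrightarrow>
     (\<forall>i. d $ i > 0) \<and> transpose (diag_mat d ** B) = - (diag_mat d ** B)"

definition pos_part :: "real^'n^'m \<Rightarrow> real^'n^'m" where
  "pos_part A = (\<chi> i j. max (A $ i $ j) 0)"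

definition only_col :: "'n \<Rightarrow> real^'n^'m \<Rightarrow> real^'n^'m" where
  "only_col k A = (\<chi> i j. if j = k then A $ i $ j else 0)"

definition only_row :: "'m \<Rightarrow> real^'n^'m \<Rightarrow> real^'n^'m" where
  "only_row k A = (\<chi> i j. if i = k then A $ i $ j else 0)"

definition J_mat :: "'n \<Rightarrow> real^'n^'n" where
  "J_mat k = diag_mat (\<chi> i. if i = k then -1 else 1)"

definition mutation :: "'n \<Rightarrow> real^'n^'n \<Rightarrow> real^'n^'n" where
  "mutation k B =
     (J_mat k + only_col k (pos_part (- B))) ** B ** (J_mat k + only_row k (pos_part B))"

text \<open>The set of reduced sequences; \<open>distinct_adj\<close> says that neighbouring letters differ.\<close>

definition reduced_words :: "'n list set" where
  "reduced_words = {w. distinct_adj w}"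

definition B_matrix :: "real^'n^'n \<Rightarrow> 'n list \<Rightarrow> real^'n^'n" where
  "B_matrix B w = fold mutation w B"

text \<open>One mutation step on a pair \<open>(B\<^sup>w, C\<^sup>w)\<close>. The characteristic recursion for
  \<open>C_matrix\<close> is \<open>C_matrix_snoc\<close> below.\<close>

definition BC_step :: "'n \<Rightarrow> (real^'n^'n) \<times> (real^'n^'n) \<Rightarrow> (real^'n^'n) \<times> (real^'n^'n)" where
  "BC_step k = (\<lambda>(B, C). (mutation k B,
     C ** J_mat k + C ** only_row k (pos_part B) + only_col k (pos_part (- C)) ** B))"

definition C_matrix :: "real^'n^'n \<Rightarrow> 'n list \<Rightarrow> real^'n^'n" where
  "C_matrix B w = snd (fold BC_step w (B, mat 1))"

lemma fst_fold_BC_step: "fst (fold BC_step w (B, C)) = B_matrix B w"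
  by (induction w arbitrary: B C) (simp_all add: B_matrix_def BC_step_def)

lemma C_matrix_Nil: "C_matrix B [] = mat 1"
  by (simp add: C_matrix_def)

lemma C_matrix_snoc:
  "C_matrix B (w @ [k]) =
     C_matrix B w ** J_mat k
     + C_matrix B w ** only_row k (pos_part (B_matrix B w))
     + only_col k (pos_part (- C_matrix B w)) ** B_matrix B w"
  by (simp add: C_matrix_def BC_step_def case_prod_unfold fst_fold_BC_step)

definition c_vector :: "real^'n^'n \<Rightarrow> 'n list \<Rightarrow> 'n \<Rightarrow> real^'n" where
  "c_vector B w i = column i (C_matrix B w)"

definition sign_mat :: "real^'n^'m \<Rightarrow> real^'n^'m" where
  "sign_mat A = (\<chi> i j. sgn (A $ i $ j))"

definition cyclic_pattern :: "real^3^3" where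
  "cyclic_pattern = vector [vector [0, -1, 1], vector [1, 0, -1], vector [-1, 1, 0]]"

definition cyclic_mat :: "real^3^3 \<Rightarrow> bool" where
  "cyclic_mat B \<longleftrightarrow> sign_mat B = cyclic_pattern \<or> sign_mat B = - cyclic_pattern"

definition cluster_cyclic :: "real^3^3 \<Rightarrow> bool" where
  "cluster_cyclic B \<longleftrightarrow> (\<forall>w\<in>reduced_words. cyclic_mat (B_matrix B w))"

text \<open>The tropical sign \<open>\<epsilon>\<^sub>i\<close> at the word \<open>[k]\<close>.\<close>

definition tropical_sign :: "'n \<Rightarrow> 'n \<Rightarrow> real" where
  "tropical_sign k i = (if i = k then -1 else 1)"

text \<open>The sign \<open>\<eta>\<^sub>i\<^sub>j\<close> for a word with first letter \<open>k\<close>; only meant for \<open>i \<noteq> j\<close>.\<close>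

definition eta :: "'n \<Rightarrow> 'n \<Rightarrow> 'n \<Rightarrow> real" where
  "eta k i j = (if k \<in> {i, j} then -1 else 1)"

end

theory Submission
  imports Defs
begin

text \<open>
  Attach to the first letter \<open>k\<^sub>1\<close> the symmetric matrix with diagonal \<open>2 d\<^sub>i\<close> and off-diagonal
  entries \<open>\<eta>\<^sub>i\<^sub>j d\<^sub>i \<bar>b\<^sub>i\<^sub>j\<bar>\<close>; the claim says that all \<open>c\<close>-vectors keep their initial norm. If the
  \<open>c\<close>-vectors are sign-coherent, mutation at \<open>m\<close> replaces \<open>c\<^sub>m\<close> by \<open>- c\<^sub>m\<close> and exactly one other
  vector \<open>c\<^sub>l\<close> by \<open>c\<^sub>l + \<bar>b\<^sub>m\<^sub>l\<bar> c\<^sub>m\<close>, which is the reflection of \<open>c\<^sub>l\<close> in \<open>c\<^sub>m\<close> as soon as their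
  inner product is \<open>- d\<^sub>m \<bar>b\<^sub>m\<^sub>l\<bar>\<close> (and not plus that). Along a reduced word, the signs of the
  \<open>c\<close>-vectors, of their inner products and of the exchange matrix follow a finite pattern which
  guarantees this. Sign-coherence persists because cluster-cyclicity forces
  \<open>\<bar>b\<^sub>i\<^sub>j b\<^sub>j\<^sub>i\<bar> \<ge> 4\<close> for every edge: otherwise alternating mutations would generate a positive
  solution of \<open>z\<^sub>n\<^sub>+\<^sub>2 = p z\<^sub>n\<^sub>+\<^sub>1 - z\<^sub>n\<close> with \<open>p < 2\<close>.
\<close>

section \<open>Skew-symmetrizers and mutation of the exchange matrix\<close>

lemma skew_symmetrizer_iff:
  "is_skew_symmetrizer d B \<longleftrightarrow> (\<forall>p. d $ p > 0) \<and> (\<forall>p q. d $ q * B $ q $ p = - (d $ p * B $ p $ q))"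
proof -
  have "(diag_mat d ** B) $ p $ q = d $ p * B $ p $ q" for p q
    by (simp add: matrix_matrix_mult_def diag_mat_def if_distrib [where f = "\<lambda>x. x * _"] cong: if_cong)
  then show ?thesis
    by (simp add: is_skew_symmetrizer_def vec_eq_iff transpose_def)
qed

lemma skew_symmetrizer_diag_zero:
  assumes "is_skew_symmetrizer d B"
  shows "B $ p $ p = 0"
proof -
  have "d $ p > 0" and "d $ p * B $ p $ p = - (d $ p * B $ p $ p)"
    using assms unfolding skew_symmetrizer_iff by blast+
  then have "d $ p > 0" and "d $ p * B $ p $ p = 0"
    by linarith+
  then show ?thesis
    by simp
qed

lemma skew_symmetrizer_scaled:
  assumes "is_skew_symmetrizer d B"
  shows "d $ q * (r * B $ q $ p) = - (d $ p * (r * B $ p $ q))"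
proof -
  have "d $ q * B $ q $ p = - (d $ p * B $ p $ q)"
    using assms unfolding skew_symmetrizer_iff by blast
  then have "r * (d $ q * B $ q $ p) = r * - (d $ p * B $ p $ q)"
    by (rule arg_cong)
  then show ?thesis
    by (simp add: mult.left_commute)
qed

lemma skew_symmetrizer_opposite_sign:
  assumes "is_skew_symmetrizer d B" and "0 < r * B $ p $ q"
  shows "r * B $ q $ p < 0"
proof -
  have d: "0 < d $ p" "0 < d $ q"
    using assms(1) unfolding skew_symmetrizer_iff by blast+
  then have "d $ q * (r * B $ q $ p) < 0"
    unfolding skew_symmetrizer_scaled[OF assms(1), of q r p] using assms(2) by simp
  then show ?thesis
    using d by (simp add: mult_less_0_iff)
qed

lemma mutation_nth:
  assumes "B $ k $ k = 0"
  shows "mutation k B $ p $ q =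
    (if p = k \<or> q = k then - B $ p $ q
     else B $ p $ q + max (- B $ p $ k) 0 * B $ k $ q + B $ p $ k * max (B $ k $ q) 0)"
proof -
  let ?L = "J_mat k + only_col k (pos_part (- B))"
  let ?R = "J_mat k + only_row k (pos_part B)"
  have L: "(?L ** B) $ p $ q = (if p = k then - B $ k $ q else B $ p $ q + max (- B $ p $ k) 0 * B $ k $ q)"
    for p q
  proof -
    have "(?L ** B) $ p $ q =
      (\<Sum>r\<in>UNIV. (if p = r then (if p = k then -1 else 1) * B $ r $ q else 0)
        + (if r = k then max (- B $ p $ k) 0 * B $ k $ q else 0))"
      unfolding matrix_matrix_mult_def
      by (auto intro!: sum.cong simp: J_mat_def diag_mat_def only_col_def pos_part_def algebra_simps)
    also have "\<dots> = (if p = k then -1 else 1) * B $ p $ q + max (- B $ p $ k) 0 * B $ k $ q"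
      by (simp add: sum.distrib)
    finally show ?thesis
      using assms by simp
  qed
  have "(X ** ?R) $ p $ q = (if q = k then -1 else 1) * X $ p $ q + X $ p $ k * max (B $ k $ q) 0"
    for X :: "real^'a^'a"
  proof -
    have "(X ** ?R) $ p $ q =
      (\<Sum>r\<in>UNIV. (if r = q then (if q = k then -1 else 1) * X $ p $ q else 0)
        + (if r = k then X $ p $ k * max (B $ k $ q) 0 else 0))"
      unfolding matrix_matrix_mult_def
      by (auto intro!: sum.cong simp: J_mat_def diag_mat_def only_row_def pos_part_def algebra_simps)
    then show ?thesis
      by (simp add: sum.distrib)
  qed
  then show ?thesis
    unfolding mutation_def L using assms by (auto simp: L)
qed

lemma skew_symmetrizer_mutation:
  assumes "is_skew_symmetrizer d B"
  shows "is_skew_symmetrizer d (mutation k B)"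
proof -
  have pos: "d $ p > 0" and skew: "d $ q * B $ q $ p = - (d $ p * B $ p $ q)" for p q
    using assms unfolding skew_symmetrizer_iff by blast+
  \<comment> \<open>By this identity, swapping \<open>p\<close> and \<open>q\<close> exchanges the
    two correction terms of the mutation up to sign.\<close>
  have max_skew: "d $ p * max (- B $ p $ k) 0 = d $ k * max (B $ k $ p) 0" for p
  proof -
    have "d $ p * max (- B $ p $ k) 0 = max (d $ p * - B $ p $ k) (d $ p * 0)"
      using pos[of p] by (simp add: max_mult_distrib_left)
    also have "\<dots> = max (d $ k * B $ k $ p) (d $ k * 0)"
      using skew[of k p] by simp
    also have "\<dots> = d $ k * max (B $ k $ p) 0"
      using pos[of k] by (simp add: max_mult_distrib_left)
    finally show ?thesis .
  qed
  have "d $ q * mutation k B $ q $ p = - (d $ p * mutation k B $ p $ q)" for p q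
  proof (cases "p = k \<or> q = k")
    case True
    then have "mutation k B $ q $ p = - B $ q $ p" "mutation k B $ p $ q = - B $ p $ q"
      by (auto simp: mutation_nth skew_symmetrizer_diag_zero[OF assms])
    then show ?thesis
      by (simp add: skew[of p q])
  next
    case False
    have "d $ q * (B $ q $ p + max (- B $ q $ k) 0 * B $ k $ p + B $ q $ k * max (B $ k $ p) 0)
      = d $ q * B $ q $ p + d $ q * max (- B $ q $ k) 0 * B $ k $ p
        + d $ q * B $ q $ k * max (B $ k $ p) 0"
      by (simp add: algebra_simps)
    also have "\<dots> = - (d $ p * B $ p $ q + d $ p * max (- B $ p $ k) 0 * B $ k $ q
        + d $ p * B $ p $ k * max (B $ k $ q) 0)"
      unfolding max_skew skew[of q p] skew[of q k] skew[of p k] by (simp add: algebra_simps)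
    also have "\<dots> = - (d $ p * (B $ p $ q + max (- B $ p $ k) 0 * B $ k $ q
        + B $ p $ k * max (B $ k $ q) 0))"
      by (simp add: algebra_simps)
    finally show ?thesis
      using False by (simp add: mutation_nth skew_symmetrizer_diag_zero[OF assms])
  qed
  then show ?thesis
    using pos unfolding skew_symmetrizer_iff by blast
qed

lemma B_matrix_snoc: "B_matrix B (w @ [k]) = mutation k (B_matrix B w)"
  by (simp add: B_matrix_def)

lemma skew_symmetrizer_B_matrix:
  "is_skew_symmetrizer d B \<Longrightarrow> is_skew_symmetrizer d (B_matrix B w)"
  by (induction w rule: rev_induct)
    (simp_all add: B_matrix_def skew_symmetrizer_mutation)

section \<open>Mutation of sign-coherent c-vectors\<close>

lemma c_vector_Nil: "c_vector B [] i = axis i 1"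
  by (simp add: c_vector_def C_matrix_Nil column_def mat_def axis_def vec_eq_iff)

text \<open>If c_k has sign \<open>r\<close>, the two corrections c_k [b_ki]_+ + [-c_k]_+ b_ki
  collapse to [r b_ki]_+ c_k; for r = -1 this is [b]_+ - b = [-b]_+.\<close>

lemma c_vector_snoc:
  assumes diag: "B_matrix B w $ k $ k = 0"
    and coherent: "0 \<le> r *\<^sub>R c_vector B w k" and r: "r = 1 \<or> r = -1"
  shows "c_vector B (w @ [k]) i =
    (if i = k then - c_vector B w k
     else c_vector B w i + max (r * B_matrix B w $ k $ i) 0 *\<^sub>R c_vector B w k)"
proof -
  let ?B = "B_matrix B w" and ?C = "C_matrix B w"
  have "C_matrix B (w @ [k]) $ p $ i =
      (if i = k then - ?C $ p $ k
       else ?C $ p $ i + max (r * ?B $ k $ i) 0 * ?C $ p $ k)" for p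
  proof -
    have J: "(?C ** J_mat k) $ p $ i = (if i = k then - ?C $ p $ k else ?C $ p $ i)"
      by (simp add: matrix_matrix_mult_def J_mat_def diag_mat_def
          if_distrib [where f = "\<lambda>x. _ * x"] cong: if_cong)
    have R: "(?C ** only_row k (pos_part ?B)) $ p $ i = ?C $ p $ k * max (?B $ k $ i) 0"
      by (simp add: matrix_matrix_mult_def only_row_def pos_part_def
          if_distrib [where f = "\<lambda>x. _ * x"] cong: if_cong)
    have L: "(only_col k (pos_part (- ?C)) ** ?B) $ p $ i = max (- ?C $ p $ k) 0 * ?B $ k $ i"
      by (simp add: matrix_matrix_mult_def only_col_def pos_part_def
          if_distrib [where f = "\<lambda>x. x * _"] cong: if_cong)
    have "0 \<le> r * ?C $ p $ k"
      using coherent by (simp add: less_eq_vec_def c_vector_def column_def)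
    then show ?thesis
      unfolding C_matrix_snoc vector_add_component J R L
      using r diag by (auto simp: max_def algebra_simps)
  qed
  then show ?thesis
    by (simp add: c_vector_def column_def vec_eq_iff)
qed

section \<open>Cyclic matrices and the lower bound on edge products\<close>

lemma UNIV_3_distinct:
  fixes p q r :: 3
  assumes "distinct [p, q, r]"
  shows "UNIV = {p, q, r}"
  by (rule sym, rule card_subset_eq) (use assms in auto)

lemma cyclic_mat_cases:
  assumes "cyclic_mat B" and "distinct [p, q, r]"
  shows "(0 < B $ p $ q \<and> 0 < B $ q $ r \<and> 0 < B $ r $ p
        \<and> B $ q $ p < 0 \<and> B $ r $ q < 0 \<and> B $ p $ r < 0)
    \<or> (B $ p $ q < 0 \<and> B $ q $ r < 0 \<and> B $ r $ p < 0
        \<and> 0 < B $ q $ p \<and> 0 < B $ r $ q \<and> 0 < B $ p $ r)"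
proof -
  have "sgn (B $ i $ j) = cyclic_pattern $ i $ j" if "sign_mat B = cyclic_pattern" for i j
    using that by (auto simp: sign_mat_def vec_eq_iff)
  moreover have "sgn (B $ i $ j) = - cyclic_pattern $ i $ j" if "sign_mat B = - cyclic_pattern" for i j
    using that by (auto simp: sign_mat_def vec_eq_iff)
  ultimately obtain s :: real where s: "s = 1 \<or> s = -1"
    and sgn: "\<And>i j. sgn (B $ i $ j) = s * cyclic_pattern $ i $ j"
    using assms(1) unfolding cyclic_mat_def by (metis mult_1 mult_minus1)
  have "p = 1 \<or> p = 2 \<or> p = 3" "q = 1 \<or> q = 2 \<or> q = 3" "r = 1 \<or> r = 2 \<or> r = 3"
    using exhaust_3 by blast+
  then show ?thesis
    using assms(2) s
    by (auto simp flip: sgn_1_pos sgn_1_neg simp: sgn cyclic_pattern_def)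
qed

text \<open>The ratios t_n = z_(n+1) / z_n satisfy t_(n+1) = p - 1 / t_n. As t + 1/t >= 2, they drop
  by at least 2 - p at each step, so p < 2 would make them negative.\<close>

lemma three_term_recurrence_positive:
  fixes z :: "nat \<Rightarrow> real"
  assumes pos: "\<And>n. 0 < z n" and rec: "\<And>n. z (Suc (Suc n)) = p * z (Suc n) - z n"
  shows "2 \<le> p"
proof (rule ccontr)
  assume "\<not> 2 \<le> p"
  then have "p < 2" by simp
  define t where "t n = z (Suc n) / z n" for n
  have t_pos: "0 < t n" for n
    using pos by (simp add: t_def)
  have t_Suc: "t (Suc n) \<le> t n - (2 - p)" for n
  proof -
    have "t (Suc n) = p - 1 / t n"
      using pos[of n] pos[of "Suc n"] by (simp add: t_def rec field_simps)
    moreover have "t n + 1 / t n - 2 = (t n - 1)\<^sup>2 / t n"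
      using t_pos[of n] by (simp add: field_simps power2_eq_square)
    moreover have "0 \<le> (t n - 1)\<^sup>2 / t n"
      using t_pos[of n] by simp
    ultimately show ?thesis by linarith
  qed
  have bound: "t n \<le> t 0 - real n * (2 - p)" for n
  proof (induction n)
    case (Suc n)
    then show ?case
      using t_Suc[of n] by (simp add: algebra_simps)
  qed simp
  obtain n where "t 0 < real n * (2 - p)"
    using \<open>p < 2\<close> reals_Archimedean3[of "2 - p"] by auto
  then show False
    using bound[of n] t_pos[of n] by linarith
qed

text \<open>In a cyclic matrix the product added to b_pq has the opposite sign. Since b_pk changes
  sign, cyclicity after the mutation forces b_pq to change sign too, so the product
  dominates.\<close>

lemma abs_mutation_nth:
  assumes skew: "is_skew_symmetrizer d B" and cyclic: "cyclic_mat B" "cyclic_mat (mutation k B)"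
    and dist: "distinct [p, q, k]"
  shows "\<bar>mutation k B $ p $ q\<bar> = \<bar>B $ p $ k\<bar> * \<bar>B $ k $ q\<bar> - \<bar>B $ p $ q\<bar>"
proof -
  have pk: "mutation k B $ p $ k = - B $ p $ k"
    and pq: "mutation k B $ p $ q =
      B $ p $ q + max (- B $ p $ k) 0 * B $ k $ q + B $ p $ k * max (B $ k $ q) 0"
    using dist by (simp_all add: mutation_nth[OF skew_symmetrizer_diag_zero[OF skew]])
  show ?thesis
    using cyclic_mat_cases[OF cyclic(1) dist] cyclic_mat_cases[OF cyclic(2) dist] pk
    by (elim disjE conjE) (simp_all add: pq max_def abs_if)
qed

text \<open>Cyclicity along all continuations of a mutation at \<open>k\<close>; unlike \<open>cluster_cyclic\<close>, this
  passes from \<open>B\<close> to its mutations without using that mutations are involutive.\<close>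

definition cyclic_after :: "3 \<Rightarrow> real^3^3 \<Rightarrow> bool" where
  "cyclic_after k B \<longleftrightarrow> (\<forall>w. distinct_adj (k # w) \<longrightarrow> cyclic_mat (B_matrix B w))"

lemma cyclic_after_imp_cyclic: "cyclic_after k B \<Longrightarrow> cyclic_mat B"
  unfolding cyclic_after_def by (drule spec[of _ "[]"]) (simp add: B_matrix_def)

lemma cyclic_after_mutation:
  assumes "cyclic_after m B" and "k \<noteq> m"
  shows "cyclic_after k (mutation k B)"
  unfolding cyclic_after_def
proof (intro allI impI)
  fix w assume "distinct_adj (k # w)"
  then have "distinct_adj (m # k # w)"
    using assms(2) by simp
  then have "cyclic_mat (B_matrix B (k # w))"
    using assms(1) unfolding cyclic_after_def by blast
  then show "cyclic_mat (B_matrix (mutation k B) w)"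
    by (simp add: B_matrix_def)
qed

lemma obtain_third:
  fixes i j :: 3
  assumes "i \<noteq> j"
  obtains k where "distinct [i, j, k]"
proof -
  have "{i, j} \<noteq> UNIV"
  proof
    assume "{i, j} = UNIV"
    then have "card {i, j} = 3" by simp
    then show False using assms by simp
  qed
  then obtain k where "k \<notin> {i, j}"
    by blast
  then show thesis
    using that[of k] assms by auto
qed

text \<open>Mutating alternately at \<open>j\<close> and \<open>i\<close> keeps \<open>\<bar>b\<^sub>i\<^sub>j\<bar>\<close> and \<open>\<bar>b\<^sub>j\<^sub>i\<bar>\<close>, while the entry
  \<open>\<bar>b\<^sub>i\<^sub>k\<bar>\<close> runs through a positive solution of \<open>z\<^sub>n\<^sub>+\<^sub>2 = (\<bar>b\<^sub>i\<^sub>j b\<^sub>j\<^sub>i\<bar> - 2) z\<^sub>n\<^sub>+\<^sub>1 - z\<^sub>n\<close>.\<close>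

lemma edge_product_ge_4_aux:
  assumes "is_skew_symmetrizer d B" and "cyclic_after m B" and "i \<noteq> j" and "j \<noteq> m"
  shows "4 \<le> \<bar>B $ i $ j\<bar> * \<bar>B $ j $ i\<bar>"
proof -
  obtain k where dist: "distinct [i, j, k]"
    using obtain_third[OF assms(3)] .
  define X where "X n = ((mutation i \<circ> mutation j) ^^ n) B" for n
  have X_Suc: "X (Suc n) = mutation i (mutation j (X n))" for n
    by (simp add: X_def)
  \<comment> \<open>Here \<open>m\<close> stands for the letter mutated last: the given one at
    first, then \<open>i\<close>. It differs from \<open>j\<close>, so the continuation stays
    reduced.\<close>
  have step: "\<exists>m. j \<noteq> m \<and> cyclic_after m (X n) \<and> is_skew_symmetrizer d (X n)
      \<and> \<bar>X n $ i $ j\<bar> = \<bar>B $ i $ j\<bar> \<and> \<bar>X n $ j $ i\<bar> = \<bar>B $ j $ i\<bar>" for n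
  proof (induction n)
    case 0
    then show ?case using assms by (auto simp: X_def)
  next
    case (Suc n)
    then obtain m where m: "j \<noteq> m" "cyclic_after m (X n)" "is_skew_symmetrizer d (X n)"
      "\<bar>X n $ i $ j\<bar> = \<bar>B $ i $ j\<bar>" "\<bar>X n $ j $ i\<bar> = \<bar>B $ j $ i\<bar>"
      by blast
    have skew: "is_skew_symmetrizer d (mutation j (X n))"
      using skew_symmetrizer_mutation m(3) .
    have "cyclic_after i (X (Suc n))"
      unfolding X_Suc using cyclic_after_mutation m(1,2) assms(3) by metis
    moreover have "is_skew_symmetrizer d (X (Suc n))"
      unfolding X_Suc using skew_symmetrizer_mutation skew .
    ultimately show ?case
      unfolding X_Suc
      using assms(3) m mutation_nth[OF skew_symmetrizer_diag_zero[OF skew], of i]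
        mutation_nth[OF skew_symmetrizer_diag_zero[OF m(3)], of j]
      by (intro exI[of _ i]) (simp add: X_Suc)
  qed
  define a b where "a = \<bar>B $ i $ j\<bar>" and "b = \<bar>B $ j $ i\<bar>"
  define x y where "x n = \<bar>X n $ i $ k\<bar>" and "y n = \<bar>X n $ j $ k\<bar>" for n
  have xy: "0 < x n \<and> x (Suc n) = a * y n - x n \<and> y (Suc n) = b * x (Suc n) - y n" for n
  proof -
    obtain m where m: "j \<noteq> m" "cyclic_after m (X n)" and skew: "is_skew_symmetrizer d (X n)"
      and ab: "\<bar>X n $ i $ j\<bar> = a" "\<bar>X n $ j $ i\<bar> = b"
      using step[of n] unfolding a_def b_def by blast
    let ?Y = "mutation j (X n)"
    have skew': "is_skew_symmetrizer d ?Y"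
      using skew_symmetrizer_mutation skew .
    have "cyclic_after j ?Y"
      using cyclic_after_mutation m by blast
    moreover from this have "cyclic_after i (X (Suc n))"
      unfolding X_Suc using cyclic_after_mutation assms(3) by blast
    ultimately have cyc: "cyclic_mat (X n)" "cyclic_mat ?Y" "cyclic_mat (mutation i ?Y)"
      using m(2) cyclic_after_imp_cyclic unfolding X_Suc by blast+
    have "0 < x n"
      using cyclic_mat_cases[OF cyc(1) dist] by (auto simp: x_def)
    moreover have Y: "\<bar>?Y $ i $ k\<bar> = a * y n - x n"
      using abs_mutation_nth[OF skew cyc(1,2), of i k] dist ab by (auto simp: x_def y_def)
    moreover have "x (Suc n) = \<bar>?Y $ i $ k\<bar>"
      by (simp add: x_def X_Suc mutation_nth[OF skew_symmetrizer_diag_zero[OF skew']])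
    moreover have "y (Suc n) = b * \<bar>?Y $ i $ k\<bar> - y n"
    proof -
      have "\<bar>?Y $ j $ k\<bar> = y n" "\<bar>?Y $ j $ i\<bar> = b"
        by (simp_all add: y_def ab mutation_nth[OF skew_symmetrizer_diag_zero[OF skew]])
      then show ?thesis
        using abs_mutation_nth[OF skew' cyc(2,3), of j k] dist
        by (auto simp: y_def X_Suc)
    qed
    ultimately show ?thesis by simp
  qed
  have "x (Suc (Suc n)) = (a * b - 2) * x (Suc n) - x n" for n
  proof -
    have "x (Suc (Suc n)) = a * y (Suc n) - x (Suc n)"
      using xy[of "Suc n"] by blast
    also have "\<dots> = a * (b * x (Suc n) - y n) - x (Suc n)"
      using xy[of n] by simp
    also have "\<dots> = (a * b - 1) * x (Suc n) - a * y n"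
      by (simp add: algebra_simps)
    also have "a * y n = x (Suc n) + x n"
      using xy[of n] by simp
    finally show ?thesis
      by (simp add: algebra_simps)
  qed
  then have "2 \<le> a * b - 2"
    using three_term_recurrence_positive[of x] xy by blast
  then show ?thesis
    by (simp add: a_def b_def)
qed

text \<open>The alternation may not start at \<open>m\<close>; since the product is symmetric, it
  can start at the other endpoint.\<close>

lemma edge_product_ge_4:
  assumes "is_skew_symmetrizer d B" and "cyclic_after m B" and "i \<noteq> j"
  shows "4 \<le> \<bar>B $ i $ j\<bar> * \<bar>B $ j $ i\<bar>"
proof (cases "j = m")
  case True
  then show ?thesis
    using edge_product_ge_4_aux[OF assms(1,2), of j i] assms(3) by (simp add: mult.commute)
qed (use edge_product_ge_4_aux assms in blast)

section \<open>Invariants of a seed and their propagation\<close>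

text \<open>The two invariants describe a seed up to the global sign \<open>r\<close>, respectively \<open>s\<close>. In
  \<open>mutable_at\<close> the seed is about to be mutated at \<open>m\<close>, which modifies only the \<open>c\<close>-vector
  at \<open>l\<close>; in \<open>mutated_at\<close> the last mutation was at \<open>k\<close>. The signs \<open>u\<close> and \<open>t\<close> record the
  two possible shapes of the Gram matrix. The inequality with the factor \<open>2\<close> survives repeated
  mutation at \<open>l\<close> and \<open>m\<close> because \<open>\<bar>b\<^sub>l\<^sub>m b\<^sub>m\<^sub>l\<bar> \<ge> 4\<close>.\<close>

definition mutable_at ::
  "(real^3 \<Rightarrow> real^3 \<Rightarrow> real) \<Rightarrow> real^3 \<Rightarrow> real^3^3 \<Rightarrow> (3 \<Rightarrow> real^3) \<Rightarrow> 3 \<Rightarrow> 3 \<Rightarrow> 3 \<Rightarrow> real \<Rightarrow> real \<Rightarrow> bool"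
  where
  "mutable_at g d B c m l n r u \<longleftrightarrow>
     distinct [m, l, n] \<and> (r = 1 \<or> r = -1) \<and> (u = 1 \<or> u = -1) \<and>
     0 < r * B $ m $ l \<and> 0 < r * B $ l $ n \<and> 0 < r * B $ n $ m \<and>
     (\<forall>p. g (c p) (c p) = 2 * d $ p) \<and>
     g (c m) (c l) = - (d $ m * (r * B $ m $ l)) \<and>
     g (c n) (c m) = u * (d $ n * (r * B $ n $ m)) \<and>
     g (c l) (c n) = - (u * (d $ l * (r * B $ l $ n))) \<and>
     0 \<le> r *\<^sub>R c m \<and> 0 \<le> - (u * r) *\<^sub>R c n \<and>
     0 \<le> r *\<^sub>R (2 *\<^sub>R c l + (r * B $ m $ l) *\<^sub>R c m)"

definition mutated_at ::
  "(real^3 \<Rightarrow> real^3 \<Rightarrow> real) \<Rightarrow> real^3 \<Rightarrow> real^3^3 \<Rightarrow> (3 \<Rightarrow> real^3) \<Rightarrow> 3 \<Rightarrow> 3 \<Rightarrow> 3 \<Rightarrow> real \<Rightarrow> real \<Rightarrow> bool"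
  where
  "mutated_at g d B c k i j s t \<longleftrightarrow>
     distinct [k, i, j] \<and> (s = 1 \<or> s = -1) \<and> (t = 1 \<or> t = -1) \<and>
     0 < s * B $ k $ i \<and> 0 < s * B $ i $ j \<and> 0 < s * B $ j $ k \<and>
     (\<forall>p. g (c p) (c p) = 2 * d $ p) \<and>
     g (c j) (c k) = - (d $ j * (s * B $ j $ k)) \<and>
     g (c k) (c i) = t * (d $ k * (s * B $ k $ i)) \<and>
     g (c i) (c j) = - (t * (d $ i * (s * B $ i $ j))) \<and>
     0 \<le> - s *\<^sub>R c k \<and> 0 \<le> s *\<^sub>R c j \<and> 0 \<le> (s * t) *\<^sub>R c i \<and>
     0 \<le> s *\<^sub>R (2 *\<^sub>R c k + (s * B $ j $ k) *\<^sub>R c j)"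

text \<open>The sign of c_m becomes \<open>r\<close> and selects the vector to be modified: c_k if m
  = j; if m = i, then c_j when t = 1, and c_k with the cycle read backwards when t = -1.\<close>

lemma mutated_at_imp_mutable_at:
  assumes mut: "mutated_at g d B c k i j s t" and skew: "is_skew_symmetrizer d B"
    and sym: "\<And>x y. g x y = g y x" and "m \<noteq> k"
  shows "\<exists>l n r u. mutable_at g d B c m l n r u"
proof -
  have st: "s = 1 \<or> s = -1" "t = 1 \<or> t = -1" and dist: "distinct [k, i, j]"
    and arrows: "0 < s * B $ k $ i" "0 < s * B $ i $ j" "0 < s * B $ j $ k"
    and norm: "\<And>p. g (c p) (c p) = 2 * d $ p"
    and gram: "g (c j) (c k) = - (d $ j * (s * B $ j $ k))"
      "g (c k) (c i) = t * (d $ k * (s * B $ k $ i))"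
      "g (c i) (c j) = - (t * (d $ i * (s * B $ i $ j)))"
    and cone: "0 \<le> - s *\<^sub>R c k" "0 \<le> s *\<^sub>R c j" "0 \<le> (s * t) *\<^sub>R c i"
      "0 \<le> s *\<^sub>R (2 *\<^sub>R c k + (s * B $ j $ k) *\<^sub>R c j)"
    using mut unfolding mutated_at_def by blast+
  note scaled = skew_symmetrizer_scaled[OF skew]
  \<comment> \<open>For m = i the vectors c_m and c_l have the same sign, so the last inequality is
    immediate; for m = j it is the one carried by \<open>mutated_at\<close>.\<close>
  have cone_sum: "0 \<le> r *\<^sub>R (2 *\<^sub>R x + b *\<^sub>R y)"
    if "0 \<le> r *\<^sub>R x" "0 \<le> r *\<^sub>R y" "0 < b" for r b :: real and x y :: "real^3"
  proof -
    have "0 \<le> 2 * (r * x $ p) + b * (r * y $ p)" for p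
      using that by (simp add: less_eq_vec_def)
    then show ?thesis
      by (simp add: less_eq_vec_def algebra_simps)
  qed
  have "m = i \<or> m = j"
    using \<open>m \<noteq> k\<close> UNIV_3_distinct[OF dist] by blast
  then consider "m = j" | "m = i" "t = 1" | "m = i" "t = -1"
    using st by blast
  then show ?thesis
  proof cases
    case 1
    have "mutable_at g d B c j k i s (- t)"
      unfolding mutable_at_def
      using dist st arrows norm gram cone sym[of "c i" "c j"]
      by (simp add: mult.commute[of t s]) auto
    then show ?thesis using 1 by blast
  next
    case 2
    have "0 \<le> s *\<^sub>R (2 *\<^sub>R c j + (s * B $ i $ j) *\<^sub>R c i)"
      using cone_sum cone arrows 2 by simp
    then have "mutable_at g d B c i j k s 1"
      unfolding mutable_at_def
      using dist st arrows norm gram cone 2 by auto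
    then show ?thesis using 2 by blast
  next
    case 3
    have opp: "0 < - s * B $ i $ k" "0 < - s * B $ k $ j" "0 < - s * B $ j $ i"
      using skew_symmetrizer_opposite_sign[OF skew] arrows by simp_all
    moreover have "0 \<le> - s *\<^sub>R (2 *\<^sub>R c k + (- s * B $ i $ k) *\<^sub>R c i)"
      by (rule cone_sum) (use cone 3 opp in simp_all)
    moreover have "g (c i) (c k) = - (d $ i * (- s * B $ i $ k))"
      using gram(2) sym[of "c i" "c k"] scaled[of i s k] 3 by simp
    moreover have "g (c j) (c i) = 1 * (d $ j * (- s * B $ j $ i))"
      using gram(3) sym[of "c i" "c j"] scaled[of j s i] 3 by simp
    moreover have "g (c k) (c j) = - (1 * (d $ k * (- s * B $ k $ j)))"
      using gram(1) sym[of "c k" "c j"] scaled[of k s j] by simp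
    moreover have "0 \<le> - s *\<^sub>R c i" "0 \<le> - (1 * - s) *\<^sub>R c j"
      using cone 3 by simp_all
    moreover have "distinct [i, k, j]" "- s = 1 \<or> - s = -1"
      using dist st by auto
    ultimately have "mutable_at g d B c i k j (- s) 1"
      unfolding mutable_at_def using norm by blast
    then show ?thesis using 3 by blast
  qed
qed

text \<open>The pair c_m, c_l is replaced by its image under the reflection in c_m, which keeps its
  inner products. As c_n stays and c_m is negated, their product changes sign, whence
  \<open>- u\<close>.\<close>

lemma mutable_at_step:
  assumes mut: "mutable_at g d B c m l n r u" and skew: "is_skew_symmetrizer d B"
    and cyclic: "cyclic_mat (mutation m B)"
    and edge: "4 \<le> \<bar>B $ l $ m\<bar> * \<bar>B $ m $ l\<bar>"
    and g: "bilinear g" and sym: "\<And>x y. g x y = g y x"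
    and c': "\<And>p. c' p = (if p = m then - c m else c p + max (r * B $ m $ p) 0 *\<^sub>R c m)"
  shows "mutated_at g d (mutation m B) c' m n l r (- u)"
proof -
  have dist: "distinct [m, l, n]" and ru: "r = 1 \<or> r = -1" "u = 1 \<or> u = -1"
    and arrows: "0 < r * B $ m $ l" "0 < r * B $ l $ n" "0 < r * B $ n $ m"
    and norm: "\<And>p. g (c p) (c p) = 2 * d $ p"
    and gram: "g (c m) (c l) = - (d $ m * (r * B $ m $ l))"
      "g (c n) (c m) = u * (d $ n * (r * B $ n $ m))"
      "g (c l) (c n) = - (u * (d $ l * (r * B $ l $ n)))"
    and cone: "0 \<le> r *\<^sub>R c m" "0 \<le> - (u * r) *\<^sub>R c n"
      "0 \<le> r *\<^sub>R (2 *\<^sub>R c l + (r * B $ m $ l) *\<^sub>R c m)"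
    using mut unfolding mutable_at_def by blast+
  note opp = skew_symmetrizer_opposite_sign[OF skew] and scaled = skew_symmetrizer_scaled[OF skew]
  define \<beta> where "\<beta> = r * B $ m $ l"
  have c'_eq: "c' m = - c m" "c' l = c l + \<beta> *\<^sub>R c m" "c' n = c n"
    using dist arrows opp[OF arrows(3)] by (auto simp: c' \<beta>_def)
  have B': "mutation m B $ m $ n = - B $ m $ n" "mutation m B $ l $ m = - B $ l $ m"
    "mutation m B $ n $ l = B $ n $ l + B $ n $ m * \<beta>"
    using dist arrows ru
    by (auto simp: \<beta>_def mutation_nth skew_symmetrizer_diag_zero[OF skew] max_def)
  have lm: "d $ l * (r * B $ l $ m) = - (d $ m * \<beta>)"
    using scaled[of l r m] by (simp add: \<beta>_def)
  have mn: "d $ m * (r * B $ m $ n) = - (d $ n * (r * B $ n $ m))"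
    using scaled .
  have nl: "d $ n * (r * B $ n $ l) = - (d $ l * (r * B $ l $ n))"
    using scaled .
  note bilin = bilinear_ladd[OF g] bilinear_radd[OF g] bilinear_lmul[OF g] bilinear_rmul[OF g]
    bilinear_lneg[OF g] bilinear_rneg[OF g]
  have ml: "g (c l) (c m) = - (d $ m * \<beta>)" and gram_ml: "g (c m) (c l) = - (d $ m * \<beta>)"
    using gram(1) sym[of "c l" "c m"] by (simp_all add: \<beta>_def)
  have arrows': "0 < r * mutation m B $ m $ n" "0 < r * mutation m B $ n $ l"
    "0 < r * mutation m B $ l $ m"
  proof -
    show mn': "0 < r * mutation m B $ m $ n" and "0 < r * mutation m B $ l $ m"
      using opp[OF arrows(3)] opp[OF arrows(1)] by (simp_all add: B')
    \<comment> \<open>The mutation formula alone leaves this sign open; cyclicity deduces it from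
      the entry at \<open>m\<close>, \<open>n\<close>.\<close>
    show "0 < r * mutation m B $ n $ l"
      using cyclic_mat_cases[OF cyclic, of m n l] dist mn' ru by auto
  qed
  have norm': "g (c' p) (c' p) = 2 * d $ p" for p
  proof -
    have "p = m \<or> p = l \<or> p = n"
      using UNIV_3_distinct[OF dist] by blast
    then show ?thesis
      by (auto simp: c'_eq bilin norm ml gram_ml algebra_simps)
  qed
  have gram'1: "g (c' l) (c' m) = - (d $ l * (r * mutation m B $ l $ m))"
    using lm by (simp add: c'_eq bilin norm ml B')
  have gram'2: "g (c' m) (c' n) = - u * (d $ m * (r * mutation m B $ m $ n))"
    using mn gram(2) sym[of "c m" "c n"] by (simp add: c'_eq bilin B')
  have gram'3: "g (c' n) (c' l) = - (- u * (d $ n * (r * mutation m B $ n $ l)))"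
  proof -
    have "g (c' n) (c' l) = u * (d $ n * (r * B $ n $ l)) + \<beta> * (u * (d $ n * (r * B $ n $ m)))"
      using gram(2,3) nl sym[of "c n" "c l"] by (simp add: c'_eq bilin)
    then show ?thesis
      by (simp add: B' algebra_simps)
  qed
  have cone': "0 \<le> r *\<^sub>R c' l" "0 \<le> r *\<^sub>R (2 *\<^sub>R c' m + (r * mutation m B $ l $ m) *\<^sub>R c' l)"
  proof -
    define \<alpha> where "\<alpha> = - (r * B $ l $ m)"
    have pos: "0 < \<alpha>" "0 < \<beta>"
      using opp[OF arrows(1)] arrows(1) by (simp_all add: \<alpha>_def \<beta>_def)
    have "\<bar>B $ l $ m\<bar> = \<alpha>" "\<bar>B $ m $ l\<bar> = \<beta>"
      using pos ru by (auto simp: \<alpha>_def \<beta>_def)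
    then have \<alpha>\<beta>: "4 \<le> \<alpha> * \<beta>"
      using edge by simp
    have "0 \<le> r * (c l $ p + \<beta> * c m $ p)
        \<and> 0 \<le> r * (2 * - c m $ p + \<alpha> * (c l $ p + \<beta> * c m $ p))" for p
    proof -
      define x y where "x = r * c m $ p" and "y = r * c l $ p"
      have x: "0 \<le> x" and y: "0 \<le> 2 * y + \<beta> * x"
        using cone(1,3) by (simp_all add: less_eq_vec_def x_def y_def \<beta>_def algebra_simps)
      \<comment> \<open>The second target is half the sum of the last two quantities: 2(-x) +
        \<alpha>(y + \<beta>x) = (\<alpha>(2y + \<beta>x) + (\<alpha>\<beta> - 4)x) / 2. This is
        where the bound 4 enters.\<close>
      have "0 \<le> \<beta> * x" "0 \<le> \<alpha> * (2 * y + \<beta> * x)" "0 \<le> (\<alpha> * \<beta> - 4) * x"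
        using x y pos \<alpha>\<beta> by simp_all
      then have "0 \<le> y + \<beta> * x" "0 \<le> 2 * - x + \<alpha> * (y + \<beta> * x)"
        using y by (simp_all add: algebra_simps)
      then show ?thesis
        by (simp add: x_def y_def algebra_simps)
    qed
    then show "0 \<le> r *\<^sub>R c' l" "0 \<le> r *\<^sub>R (2 *\<^sub>R c' m + (r * mutation m B $ l $ m) *\<^sub>R c' l)"
      by (simp_all add: less_eq_vec_def c'_eq B' \<alpha>_def)
  qed
  have "0 \<le> - r *\<^sub>R c' m" "0 \<le> (r * - u) *\<^sub>R c' n"
    using cone(1,2) by (simp_all add: c'_eq mult.commute)
  then show ?thesis
    unfolding mutated_at_def
    using dist ru arrows' norm' gram'1 gram'2 gram'3 cone' by auto
qed

section \<open>The form attached to the first letter\<close>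

text \<open>The matrix is diag(d) times a quasi-Cartan companion of \<open>B\<close>. The diagonal 2
  d_p makes the value at (x, x) twice the quadratic form of the theorem.\<close>

definition initial_form :: "'n::finite \<Rightarrow> real^'n \<Rightarrow> real^'n^'n \<Rightarrow> real^'n \<Rightarrow> real^'n \<Rightarrow> real" where
  "initial_form k d B x y =
     x \<bullet> ((\<chi> p q. if p = q then 2 * d $ p else eta k p q * (d $ p * \<bar>B $ p $ q\<bar>)) *v y)"

lemma bilinear_initial_form: "bilinear (initial_form k d B)"
  by (simp add: bilinear_def linear_iff initial_form_def matrix_vector_right_distrib
      matrix_vector_mult_scaleR inner_add_left inner_add_right)

lemma initial_form_axis:
  "initial_form k d B (axis p 1) (axis q 1) =
     (if p = q then 2 * d $ p else eta k p q * (d $ p * \<bar>B $ p $ q\<bar>))"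
  by (simp add: initial_form_def inner_axis' column_def matrix_vector_mult_basis)

lemma skew_symmetrizer_abs:
  assumes "is_skew_symmetrizer d B"
  shows "d $ q * \<bar>B $ q $ p\<bar> = d $ p * \<bar>B $ p $ q\<bar>"
proof -
  have d: "\<And>p. 0 < d $ p" and B: "d $ q * B $ q $ p = - (d $ p * B $ p $ q)"
    using assms unfolding skew_symmetrizer_iff by blast+
  have "\<bar>d $ q * B $ q $ p\<bar> = \<bar>d $ p * B $ p $ q\<bar>"
    unfolding B by simp
  then show ?thesis
    using d[of p] d[of q] by (simp add: abs_mult)
qed

lemma initial_form_commute:
  assumes "is_skew_symmetrizer d B"
  shows "initial_form k d B x y = initial_form k d B y x"
proof -
  define A :: "real^'a^'a" where
    "A = (\<chi> p q. if p = q then 2 * d $ p else eta k p q * (d $ p * \<bar>B $ p $ q\<bar>))"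
  have "transpose A = A"
    by (auto simp: A_def transpose_def vec_eq_iff eta_def skew_symmetrizer_abs[OF assms])
  then have "x v* A = A *v x"
    by (metis transpose_matrix_vector)
  then have "x \<bullet> (A *v y) = (A *v x) \<bullet> y"
    by (metis dot_lmul_matrix)
  then show ?thesis
    by (simp add: initial_form_def A_def inner_commute)
qed

text \<open>The unit vectors are nonnegative, so r = 1, and \<open>l\<close> is the index with b_kl
  > 0. The signs \<open>eta\<close> are -1 on both edges at \<open>k\<close> and 1 on the opposite
  edge, which is the shape u = -1.\<close>

lemma mutable_at_initial:
  assumes skew: "is_skew_symmetrizer d B" and cyclic: "cyclic_mat B"
  shows "\<exists>l n. mutable_at (initial_form k d B) d B (\<lambda>p. axis p 1) k l n 1 (- 1)"
proof -
  have "\<exists>l n. distinct [k, l, n] \<and> 0 < B $ k $ l \<and> 0 < B $ l $ n \<and> 0 < B $ n $ k"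
  proof -
    have "k \<noteq> k + 1"
      by simp
    then obtain j where "distinct [k, k + 1, j]"
      using obtain_third by blast
    moreover from this have "distinct [k, j, k + 1]"
      by auto
    ultimately show ?thesis
      using cyclic_mat_cases[OF cyclic, of k "k + 1" j] by blast
  qed
  then obtain l n where dist: "distinct [k, l, n]"
    and arrows: "0 < B $ k $ l" "0 < B $ l $ n" "0 < B $ n $ k"
    by blast
  have cone: "0 \<le> (axis k 1 :: real^3)" "0 \<le> (axis n 1 :: real^3)"
    "0 \<le> 2 *\<^sub>R axis l 1 + B $ k $ l *\<^sub>R (axis k 1 :: real^3)"
    using arrows by (simp_all add: less_eq_vec_def axis_def)
  have "mutable_at (initial_form k d B) d B (\<lambda>p. axis p 1) k l n 1 (- 1)"
    using dist arrows cone by (auto simp: mutable_at_def initial_form_axis eta_def)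
  then show ?thesis by blast
qed

section \<open>Induction along the reduced word\<close>

text \<open>The empty word is excluded: \<open>mutated_at\<close> asks for c-vectors of opposite
  signs, while the initial ones are all nonnegative.\<close>

lemma mutated_at_c_vector:
  assumes skew: "is_skew_symmetrizer d B" and cyclic: "cluster_cyclic B"
    and "distinct_adj w" and "w \<noteq> []"
  shows "cyclic_after (last w) (B_matrix B w) \<and> (\<exists>i j s t.
    mutated_at (initial_form (hd w) d B) d (B_matrix B w) (c_vector B w) (last w) i j s t)"
  using assms(3,4)
proof (induction w rule: rev_induct)
  case Nil
  then show ?case by simp
next
  case (snoc m w)
  let ?g = "initial_form (hd (w @ [m])) d B"
  have skew': "is_skew_symmetrizer d (B_matrix B w)"
    using skew_symmetrizer_B_matrix skew .
  have "\<exists>k l n r u. m \<noteq> k \<and> cyclic_after k (B_matrix B w)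
    \<and> mutable_at ?g d (B_matrix B w) (c_vector B w) m l n r u"
  proof (cases "w = []")
    case True
    \<comment> \<open>Before the first mutation there is no last letter, so any index other than
      \<open>m\<close> can take its place.\<close>
    obtain k where "m \<noteq> k"
      using obtain_third[of m "m + 1"] by auto
    moreover have "cyclic_after k B"
      using cyclic by (auto simp: cyclic_after_def cluster_cyclic_def reduced_words_def
          dest: distinct_adj_ConsD)
    moreover have "B_matrix B w = B" "c_vector B w = (\<lambda>p. axis p 1)" "hd (w @ [m]) = m"
      using True c_vector_Nil by (auto simp: B_matrix_def)
    ultimately show ?thesis
      using mutable_at_initial[OF skew cyclic_after_imp_cyclic, of k m] by metis
  next
    case False
    then have "distinct_adj w" and m: "m \<noteq> last w" and hd: "hd (w @ [m]) = hd w"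
      using snoc.prems(1) by (auto simp: distinct_adj_append_iff)
    then obtain i j s t where "cyclic_after (last w) (B_matrix B w)"
      and "mutated_at ?g d (B_matrix B w) (c_vector B w) (last w) i j s t"
      using snoc.IH False by metis
    then show ?thesis
      using mutated_at_imp_mutable_at skew' initial_form_commute[OF skew] m by metis
  qed
  then obtain k l n r u where k: "m \<noteq> k" "cyclic_after k (B_matrix B w)"
    and mut: "mutable_at ?g d (B_matrix B w) (c_vector B w) m l n r u"
    by blast
  have after: "cyclic_after m (mutation m (B_matrix B w))"
    using cyclic_after_mutation k by blast
  have "l \<noteq> m" "r = 1 \<or> r = -1" "0 \<le> r *\<^sub>R c_vector B w m"
    using mut unfolding mutable_at_def by force+
  then have "mutated_at ?g d (mutation m (B_matrix B w)) (c_vector B (w @ [m])) m n l r (- u)"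
    using mutable_at_step[OF mut skew' cyclic_after_imp_cyclic[OF after]
        edge_product_ge_4[OF skew' k(2)] bilinear_initial_form initial_form_commute[OF skew]]
      c_vector_snoc[OF skew_symmetrizer_diag_zero[OF skew']]
    by blast
  then show ?case
    using after by (auto simp: B_matrix_snoc)
qed

theorem theorem4p10:
  fixes B :: "real^3^3" and d :: "real^3" and w :: "3 list" and i :: 3
    and x\<^sub>1 x\<^sub>2 x\<^sub>3 :: real
  assumes "is_skew_symmetrizer d B"
    and "cluster_cyclic B"
    and "w \<in> reduced_words" and "w \<noteq> []"
    and "c_vector B w i = vector [x\<^sub>1, x\<^sub>2, x\<^sub>3]"
  shows "(d$1 * x\<^sub>1^2 + d$2 * x\<^sub>2^2 + d$3 * x\<^sub>3^2
      + eta (hd w) 1 2 * d$1 * \<bar>B$1$2\<bar> * x\<^sub>1 * x\<^sub>2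
      + eta (hd w) 2 3 * d$2 * \<bar>B$2$3\<bar> * x\<^sub>2 * x\<^sub>3
      + eta (hd w) 1 3 * d$3 * \<bar>B$3$1\<bar> * x\<^sub>1 * x\<^sub>3 = d$i)
    \<and> (\<forall>p q. p \<noteq> q \<longrightarrow> eta (hd w) p q = tropical_sign (hd w) p * tropical_sign (hd w) q)
    \<and> (hd w = 1 \<longrightarrow>
      d$1 * x\<^sub>1^2 + d$2 * x\<^sub>2^2 + d$3 * x\<^sub>3^2
      - d$1 * \<bar>B$1$2\<bar> * x\<^sub>1 * x\<^sub>2 + d$2 * \<bar>B$2$3\<bar> * x\<^sub>2 * x\<^sub>3 - d$3 * \<bar>B$3$1\<bar> * x\<^sub>1 * x\<^sub>3 = d$i)
    \<and> (hd w = 2 \<longrightarrow>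
      d$1 * x\<^sub>1^2 + d$2 * x\<^sub>2^2 + d$3 * x\<^sub>3^2
      - d$1 * \<bar>B$1$2\<bar> * x\<^sub>1 * x\<^sub>2 - d$2 * \<bar>B$2$3\<bar> * x\<^sub>2 * x\<^sub>3 + d$3 * \<bar>B$3$1\<bar> * x\<^sub>1 * x\<^sub>3 = d$i)
    \<and> (hd w = 3 \<longrightarrow>
      d$1 * x\<^sub>1^2 + d$2 * x\<^sub>2^2 + d$3 * x\<^sub>3^2
      + d$1 * \<bar>B$1$2\<bar> * x\<^sub>1 * x\<^sub>2 - d$2 * \<bar>B$2$3\<bar> * x\<^sub>2 * x\<^sub>3 - d$3 * \<bar>B$3$1\<bar> * x\<^sub>1 * x\<^sub>3 = d$i)"
proof -
  let ?x = "c_vector B w i"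
  have "initial_form (hd w) d B ?x ?x = 2 * d $ i"
    using mutated_at_c_vector[of d B w] assms(1-4)
    unfolding mutated_at_def reduced_words_def by blast
  moreover have "initial_form (hd w) d B ?x ?x =
    2 * (d$1 * x\<^sub>1^2 + d$2 * x\<^sub>2^2 + d$3 * x\<^sub>3^2
      + eta (hd w) 1 2 * d$1 * \<bar>B$1$2\<bar> * x\<^sub>1 * x\<^sub>2
      + eta (hd w) 2 3 * d$2 * \<bar>B$2$3\<bar> * x\<^sub>2 * x\<^sub>3
      + eta (hd w) 1 3 * d$3 * \<bar>B$3$1\<bar> * x\<^sub>1 * x\<^sub>3)"
  proof -
    \<comment> \<open>Symmetric entries coincide, so each mixed term occurs twice, matching the
      doubled diagonal.\<close>
    have "eta (hd w) 2 1 = eta (hd w) 1 2" "eta (hd w) 3 2 = eta (hd w) 2 3"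
      "eta (hd w) 3 1 = eta (hd w) 1 3"
      by (auto simp: eta_def)
    then show ?thesis
      unfolding assms(5) initial_form_def
      using skew_symmetrizer_abs[OF assms(1), of 2 1] skew_symmetrizer_abs[OF assms(1), of 3 2]
        skew_symmetrizer_abs[OF assms(1), of 1 3]
      by (simp add: inner_vec_def matrix_vector_mult_def sum_3 algebra_simps power2_eq_square)
  qed
  ultimately have form: "d$1 * x\<^sub>1^2 + d$2 * x\<^sub>2^2 + d$3 * x\<^sub>3^2
      + eta (hd w) 1 2 * d$1 * \<bar>B$1$2\<bar> * x\<^sub>1 * x\<^sub>2
      + eta (hd w) 2 3 * d$2 * \<bar>B$2$3\<bar> * x\<^sub>2 * x\<^sub>3
      + eta (hd w) 1 3 * d$3 * \<bar>B$3$1\<bar> * x\<^sub>1 * x\<^sub>3 = d$i"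
    by simp
  have tropical: "\<forall>p q. p \<noteq> q \<longrightarrow>
      eta (hd w) p q = tropical_sign (hd w) p * tropical_sign (hd w) q"
    by (auto simp: eta_def tropical_sign_def)
  show ?thesis
    by (intro conjI form tropical) (use form in \<open>auto simp: eta_def\<close>)
qed

end
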